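(* Let $m$ and $n$ be non-negative integers and $q$ an indeterminate. Then $$ D_q(m,n)=\sum_{k=0}^{m}q^{(m-k)(n-k)}{m\brack k}{n\brack k}(-1;q)_k, $$ $$ D^*_q(n,m)=\sum_{k=0}^{m}q^{(m-k)(n-k)}{m\brack k}{n\brack k}(-q;q)_k. $$ Moreover, $$ D_q(m,n)\,D^*_{q}(m,n)=\sum_{k=0}^{n}q^{(m-k)(n-k)}{n+k\brack 2k}{m\brack k}{m+k\brack k}(-1;q)_k(-q;q)_k. $$
   Context: The $q$-shifted factorial is $(a;q)_0=1$ and $(a;q)_k=(1-a)(1-aq)\cdots(1-aq^{k-1})$ for $k\geq 1$. The $q$-binomial coefficient is ${n\brack k}=\frac{(q;q)_n}{(q;q)_k(q;q)_{n-k}}$ if $n\ge k\ge 0$, and ${n\brack k}=0$ otherwise. The two $q$-Delannoy numbers are $$ D_q(m,n)=\sum_{k=0}^{n}q^{\binom{k}{2}}{n\brack k}{n+m-k\brack n},\qquad D^*_q(m,n)=\sum_{k=0}^{n}q^{\binom{k+1}{2}}{n\brack k}{n+m-k\brack n}. $$ *)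

theory Defs
  imports
    "HOL-Computational_Algebra.Polynomial"
    "HOL-Computational_Algebra.Fraction_Field"
begin

text \<open>
  The definitions below make sense for an element \<open>q\<close> of any field.  The quotient defining
  \<open>q_binomial\<close> is the intended one whenever \<open>q\<close> is not a root of unity, in particular for
  the indeterminate \<open>q_indet\<close> (division by zero yields zero in HOL).
\<close>

definition q_shifted_fact :: "'a::field \<Rightarrow> 'a \<Rightarrow> nat \<Rightarrow> 'a" where
  "q_shifted_fact a q k = (\<Prod>i<k. 1 - a * q ^ i)"

definition q_binomial :: "'a::field \<Rightarrow> nat \<Rightarrow> nat \<Rightarrow> 'a" where
  "q_binomial q n k =
     (if k \<le> n
      then q_shifted_fact q q n / (q_shifted_fact q q k * q_shifted_fact q q (n - k))
      else 0)"

text \<open>In both sums \<open>k \<le> n\<close>, so the natural-number subtraction \<open>n + m - k\<close> never truncates.\<close>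

definition q_delannoy :: "'a::field \<Rightarrow> nat \<Rightarrow> nat \<Rightarrow> 'a" where
  "q_delannoy q m n =
     (\<Sum>k=0..n. q ^ (k choose 2) * q_binomial q n k * q_binomial q (n + m - k) n)"

definition q_delannoy_star :: "'a::field \<Rightarrow> nat \<Rightarrow> nat \<Rightarrow> 'a" where
  "q_delannoy_star q m n =
     (\<Sum>k=0..n. q ^ ((k + 1) choose 2) * q_binomial q n k * q_binomial q (n + m - k) n)"

text \<open>
  The indeterminate, as an element of the field of rational functions in one variable, i.e. of
  the fraction field of the polynomial ring over an integral domain.
\<close>

definition q_indet :: "'a::idom poly fract" where
  "q_indet = Fract [:0, 1:] 1"

end

theory Submission
  imports Defs
begin

text \<open>
  Write \<open>[n,k]\<close> for q-binomial coefficients. The Delannoy numbers are values of one polynomial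
  \<open>F(x) = \<Sum>\<^sub>k x\<^sup>k q^(k choose 2) T\<^sub>k\<close> with \<open>T\<^sub>k = [n,k] [n+m-k,n]\<close>; it vanishes
  unless \<open>k \<le> min m n\<close>, and then
  \<open>T\<^sub>k = (q;q)\<^sub>(n+m-k) / ((q;q)\<^sub>k (q;q)\<^sub>(n-k) (q;q)\<^sub>(m-k))\<close> is symmetric in \<open>m\<close> and \<open>n\<close>. One has
  \<open>D\<^sub>q(m,n) = F(1)\<close> and \<open>D\<^sup>*\<^sub>q(m,n) = F(q)\<close>.

  The two expansions are the cases \<open>a = -1\<close> and \<open>a = -q\<close> of an expansion of \<open>F(-a)\<close> in the basis
  \<open>(a;q)\<^sub>k\<close>, lemma \<open>delannoy_poly_expand\<close>. Expanding each \<open>(a;q)\<^sub>k\<close> by the q-binomial theorem and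
  collecting the powers of \<open>a\<close> reduces it to the q-Vandermonde convolution.

  The product formula is the case \<open>x = y = 1\<close> of a formula for \<open>F(x) F(y q)\<close> with \<open>x y = 1\<close>, lemma
  \<open>delannoy_poly_product\<close>. Having a parameter suggests comparing the coefficients of \<open>x\<^sup>j\<close>. On
  the right they come from the finite Jacobi triple product, which expands \<open>(-x;q)\<^sub>k (-y q;q)\<^sub>k\<close>;
  on the left they are the correlations \<open>\<Sum>\<^sub>l q^(l(l+j)) T\<^sub>l T\<^sub>(l+j)\<close>,
  up to the same power of \<open>q\<close>. That the two agree, lemma
  \<open>delannoy_coeff_correlation\<close>, is an instance of the Sears transformation of terminating
  balanced 4-phi-3 series, and is proved like it: up to a constant factor, both sides are iterated sums of one
  double sum, whose inner sums are evaluated in either order by the q-Pfaff-Saalschuetz theorem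
  (\<open>q_saalschuetz_qfact\<close>). The latter follows from a polynomial identity in three variables
  (\<open>q_saalschuetz_polynomial\<close>) that is proved by telescoping.
\<close>

section \<open>Binomial exponents and sums over a square\<close>

lemma choose_two_add: "(m + n) choose 2 = (m choose 2) + (n choose 2) + m * n"
  by (induction n) (simp_all add: numeral_2_eq_2 binomial_eq_0)

lemma Suc_choose_two: "Suc n choose 2 = (n choose 2) + n"
  by (simp add: numeral_2_eq_2)

lemma prod_lessThan_add:
  fixes f :: "nat \<Rightarrow> 'b::comm_monoid_mult"
  shows "(\<Prod>i<m + n. f i) = (\<Prod>i<m. f i) * (\<Prod>i<n. f (m + i))"
  by (induction n) (simp_all add: mult.assoc)

text \<open>
  The part \<open>i \<ge> l\<close> of the square is parametrised by \<open>j = i - l \<ge> 0\<close>, the part \<open>i < l\<close> by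
  \<open>j = l - i\<close>; the conditional keeps the main diagonal from being counted twice.
\<close>

lemma sum_square_by_diagonals:
  fixes f :: "nat \<Rightarrow> nat \<Rightarrow> 'b::comm_monoid_add"
  shows "(\<Sum>i\<le>M. \<Sum>l\<le>M. f i l) =
    (\<Sum>j\<le>M. \<Sum>l\<le>M - j. f (l + j) l + (if j = 0 then 0 else f l (l + j)))"
proof (induction M)
  case 0
  show ?case by simp
next
  case (Suc M)
  define g where "g j l = f (l + j) l + (if j = 0 then 0 else f l (l + j))" for j l
  have rev: "(\<Sum>j\<le>Suc M. h (Suc M - j)) = (\<Sum>j\<le>Suc M. h j)" for h :: "nat \<Rightarrow> 'b"
    by (rule sum.reindex_bij_witness[where i = "\<lambda>j. Suc M - j" and j = "\<lambda>j. Suc M - j"]) auto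
  have "(\<Sum>j\<le>Suc M. \<Sum>l\<le>Suc M - j. g j l) =
    (\<Sum>j\<le>M. \<Sum>l\<le>M - j. g j l) + (\<Sum>j\<le>Suc M. g j (Suc M - j))"
    by (simp add: Suc_diff_le sum.distrib add_ac)
  also have "(\<Sum>j\<le>Suc M. g j (Suc M - j)) =
    (\<Sum>j\<le>Suc M. f (Suc M) (Suc M - j) + (if Suc M - j = Suc M then 0 else f (Suc M - j) (Suc M)))"
    by (rule sum.cong) (auto simp: g_def)
  also have "\<dots> = (\<Sum>l\<le>Suc M. f (Suc M) l + (if l = Suc M then 0 else f l (Suc M)))"
    by (rule rev)
  also have "\<dots> = (\<Sum>l\<le>Suc M. f (Suc M) l) + (\<Sum>l\<le>M. f l (Suc M))"
    by (simp add: sum.distrib add_ac)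
  finally show ?case
    using Suc.IH by (simp add: g_def sum.distrib add_ac)
qed

section \<open>Products and q-Pascal rules\<close>

lemma q_shifted_fact_0 [simp]: "q_shifted_fact a q 0 = 1"
  by (simp add: q_shifted_fact_def)

lemma q_shifted_fact_Suc: "q_shifted_fact a q (Suc k) = q_shifted_fact a q k * (1 - a * q ^ k)"
  by (simp add: q_shifted_fact_def)

lemma q_shifted_fact_add: "q_shifted_fact a q (k + l) = q_shifted_fact a q k * q_shifted_fact (a * q ^ k) q l"
  by (induction l) (simp_all add: q_shifted_fact_Suc power_add mult.assoc)

lemma q_shifted_fact_Suc_left: "q_shifted_fact a q (Suc k) = (1 - a) * q_shifted_fact (a * q) q k"
  using q_shifted_fact_add[of a q 1 k] by (simp add: q_shifted_fact_Suc)

lemma q_binomial_eq_0: "n < k \<Longrightarrow> q_binomial q n k = 0"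
  by (simp add: q_binomial_def)

text \<open>
  For \<open>A \<noteq> 0\<close> this is \<open>A\<^sup>k (1/A;q)\<^sub>k\<close>, without the division.
\<close>

definition q_falling :: "'a::field \<Rightarrow> 'a \<Rightarrow> nat \<Rightarrow> 'a" where
  "q_falling A q k = (\<Prod>i<k. A - q ^ i)"

lemma q_falling_0 [simp]: "q_falling A q 0 = 1"
  by (simp add: q_falling_def)

lemma q_falling_Suc: "q_falling A q (Suc k) = q_falling A q k * (A - q ^ k)"
  by (simp add: q_falling_def)

text \<open>
  An indeterminate enters the proofs only through two properties: it is invertible, and no
  positive power of it is 1, so that every \<open>(q;q)\<^sub>n\<close> is invertible.
\<close>

locale generic_q =
  fixes q :: "'a::field"
  assumes q_nonzero: "q \<noteq> 0"
    and q_power_neq_1: "0 < i \<Longrightarrow> q ^ i \<noteq> 1"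
begin

abbreviation qfact :: "nat \<Rightarrow> 'a" where "qfact n \<equiv> q_shifted_fact q q n"
abbreviation qbin :: "nat \<Rightarrow> nat \<Rightarrow> 'a" where "qbin n k \<equiv> q_binomial q n k"

lemma qfact_Suc: "qfact (Suc n) = qfact n * (1 - q ^ Suc n)"
  by (simp add: q_shifted_fact_Suc)

lemma one_minus_q_power_nonzero: "1 - q ^ Suc n \<noteq> 0"
  using q_power_neq_1[of "Suc n"] by (metis eq_iff_diff_eq_0 zero_less_Suc)

lemma qfact_nonzero [simp]: "qfact n \<noteq> 0"
  by (induction n) (use one_minus_q_power_nonzero in \<open>simp_all add: qfact_Suc\<close>)

lemma qbin_add: "qbin (k + l) k = qfact (k + l) / (qfact k * qfact l)"
  by (simp add: q_binomial_def)

lemma qbin_0 [simp]: "qbin n 0 = 1"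
  by (simp add: q_binomial_def)

lemma qbin_refl [simp]: "qbin n n = 1"
  by (simp add: q_binomial_def)

lemma q_pascal:
  "qbin (Suc n) (Suc k) = qbin n k + q ^ Suc k * qbin n (Suc k)" (is ?A)
  "qbin (Suc n) (Suc k) = q ^ (n - k) * qbin n k + qbin n (Suc k)" (is ?B)
proof -
  consider "n < k" | "n = k" | l where "n = k + Suc l"
    by (metis less_imp_Suc_add linorder_neqE_nat add_Suc_right)
  then have "?A \<and> ?B"
  proof cases
    case 3
    define K L where "K = q ^ Suc k" and "L = q ^ Suc l"
    have nz: "1 - K \<noteq> 0" "1 - L \<noteq> 0" unfolding K_def L_def by (rule one_minus_q_power_nonzero)+
    have 0: "qbin (Suc n) (Suc k) = qfact n * (1 - K * L) / (qfact k * (1 - K) * (qfact l * (1 - L)))"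
      using qbin_add[of "Suc k" "Suc l"] 
      by (simp add: 3 qfact_Suc[of k] qfact_Suc[of l] qfact_Suc[of "Suc (k+l)"] K_def L_def power_add mult_ac)
    have 1: "qbin n k = qfact n / (qfact k * (qfact l * (1 - L)))"
      using qbin_add[of k "Suc l"] by (simp add: 3 qfact_Suc[of l] L_def)
    have 2: "qbin n (Suc k) = qfact n / (qfact k * (1 - K) * qfact l)"
      using qbin_add[of "Suc k" l] by (simp add: 3 qfact_Suc[of k] K_def)
    have 4: "q ^ (n - k) = L" by (simp add: 3 L_def)
    show ?thesis unfolding 0 1 2 4 K_def[symmetric] using nz
      by (simp add: divide_simps) (simp add: algebra_simps)
  qed (simp_all add: q_binomial_eq_0)
  then show ?A ?B by auto
qed

section \<open>Summation theorems\<close>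

text \<open>
  The q-Pfaff-Saalschuetz sum with parameters \<open>1/A\<close>, \<open>1/B\<close>, \<open>c\<close>, cleared of all denominators.
  It is proved by the Wilf-Zeilberger method: if \<open>t N k\<close> is the summand and \<open>E\<close> is the factor
  that the right-hand side gains from \<open>N\<close> to \<open>N + 1\<close>, then \<open>t (N + 1) k - E * t N k\<close> is a difference
  in \<open>k\<close> of an explicit function.
\<close>

lemma q_saalschuetz_polynomial:
  "(\<Sum>k\<le>N. qbin N k * c ^ k * q_falling A q k * q_falling B q k *
        q_shifted_fact (c * q ^ k) q (N - k) * q_shifted_fact (c * A * B) q (N - k)) =
   q_shifted_fact (c * A) q N * q_shifted_fact (c * B) q N"
proof (induction N)
  case 0
  show ?case by simp
next
  case (Suc N)
  define t where "t N k = qbin N k * c ^ k * q_falling A q k * q_falling B q k *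
        q_shifted_fact (c * q ^ k) q (N - k) * q_shifted_fact (c * A * B) q (N - k)" for N k
  \<comment> \<open>The certificate \<open>G\<close> vanishes at \<open>0\<close>; shifting the index avoids a q-binomial coefficient with
    lower entry \<open>k - 1\<close>.\<close>
  define g where "g k = q ^ (N - k) * qbin N k * c ^ Suc k * q_falling A q (Suc k) *
        q_falling B q (Suc k) * q_shifted_fact (c * q ^ k) q (N - k) *
        q_shifted_fact (c * A * B) q (N - k)" for k
  define G where "G k = (case k of 0 \<Rightarrow> 0 | Suc i \<Rightarrow> g i)" for k
  define E where "E = (1 - c * A * q ^ N) * (1 - c * B * q ^ N)"
  have step: "t (Suc N) k - E * t N k = G k - G (Suc k)" if le: "k \<le> N" for k
  proof -
    obtain e where e: "N = k + e" using le le_Suc_ex by blast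
    define X where "X = c ^ k * q_falling A q k * q_falling B q k *
        q_shifted_fact (c * q ^ k) q e * q_shifted_fact (c * A * B) q e"
    have t1: "t (Suc N) k = X * (qbin (Suc N) k * (1 - c * q ^ N) * (1 - c * A * B * q ^ e))"
      by (simp add: t_def X_def e Suc_diff_le q_shifted_fact_Suc power_add mult_ac)
    have t0: "t N k = X * qbin N k"
      by (simp add: t_def X_def e)
    have g1: "G (Suc k) = X * (q ^ e * qbin N k * c * (A - q ^ k) * (B - q ^ k))"
      by (simp add: G_def g_def X_def e q_falling_Suc)
    show ?thesis
    proof (cases k)
      case 0
      with e show ?thesis unfolding t1 t0 g1
        by (simp add: G_def E_def) (simp add: algebra_simps)
    next
      case (Suc i)
      have ge: "G k = X * (q ^ Suc e * qbin N i * (1 - c * q ^ i) * (1 - c * A * B * q ^ e))"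
        by (simp add: G_def g_def X_def e Suc q_shifted_fact_Suc_left[of "c * q ^ i"] q_shifted_fact_Suc[of "A * (B * c)"] mult_ac)
      define a b where "a = qbin N i" and "b = qbin N k"
      define K L where "K = q ^ i" and "L = q ^ e"
      have "q ^ N = q * K * L" "q ^ k = q * K" by (simp_all add: e Suc K_def L_def power_add)
      note pw = this
      have p1: "qbin (Suc N) k = a + q * K * b" using q_pascal(1)[of N i] by (simp add: a_def b_def K_def Suc)
      have "qbin (Suc N) k = q * L * a + b"
        using q_pascal(2)[of N i] by (simp add: a_def b_def L_def Suc e)
      then have p2: "a = q * L * a + b - q * K * b" using p1 by (simp add: algebra_simps)
      \<comment> \<open>After division by \<open>X\<close>, the telescoping relation is a consequence of the two q-Pascal rules
        for \<open>qbin (Suc N) k\<close>.\<close>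
      have "qbin (Suc N) k * (1 - c * q ^ N) * (1 - c * A * B * q ^ e) - E * qbin N k =
        q ^ Suc e * qbin N i * (1 - c * q ^ i) * (1 - c * A * B * q ^ e) -
        q ^ e * qbin N k * c * (A - q ^ k) * (B - q ^ k)"
        unfolding p1 E_def pw using p2
        unfolding power_Suc K_def[symmetric] L_def[symmetric] a_def[symmetric] b_def[symmetric]
        by algebra
      then have "X * (qbin (Suc N) k * (1 - c * q ^ N) * (1 - c * A * B * q ^ e) - E * qbin N k) =
        X * (q ^ Suc e * qbin N i * (1 - c * q ^ i) * (1 - c * A * B * q ^ e) -
        q ^ e * qbin N k * c * (A - q ^ k) * (B - q ^ k))" by simp
      then show ?thesis unfolding t1 t0 g1 ge
        by (simp only: right_diff_distrib mult_ac)
    qed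
  qed
  have last: "t (Suc N) (Suc N) = G (Suc N)"
    by (simp add: t_def G_def g_def)
  have "(\<Sum>k\<le>N. t (Suc N) k) - E * (\<Sum>k\<le>N. t N k) = (\<Sum>k\<le>N. G k - G (Suc k))"
    by (simp add: sum_distrib_left step flip: sum_subtractf)
  also have "\<dots> = - G (Suc N)"
    using sum_telescope[of G N] by (simp add: G_def)
  finally have "(\<Sum>k\<le>Suc N. t (Suc N) k) = E * (\<Sum>k\<le>N. t N k)"
    using last by (simp add: algebra_simps)
  then show ?case
    using Suc.IH by (simp add: t_def E_def q_shifted_fact_Suc mult_ac)
qed

text \<open>
  With one q-Pascal rule for \<open>qbin (N + 1) i\<close> the left-hand side for \<open>N + 1\<close> splits into the left-hand
  sides for \<open>N\<close> at \<open>j\<close> and at \<open>j + 1\<close>, and the other q-Pascal rule reassembles the right-hand sides. The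
  exponent is truncated only when \<open>n < i + j\<close>, where \<open>qbin n (i + j)\<close> vanishes.
\<close>

lemma q_vandermonde:
  "(\<Sum>i\<le>N. q ^ ((N - i) * (n - j - i)) * qbin N i * qbin n (i + j)) = qbin (N + n) (N + j)"
proof (induction N arbitrary: j)
  case 0
  show ?case by simp
next
  case (Suc N)
  define f where "f i = q ^ ((Suc N - i) * (n - j - i)) * qbin (Suc N) i * qbin n (i + j)" for i
  define g where "g i = q ^ ((N - i) * (n - j - i)) * qbin N i * qbin n (i + j)" for i
  define h where "h i = q ^ ((N - i) * (n - Suc j - i)) * qbin N i * qbin n (i + Suc j)" for i
  have fS: "f (Suc i) = h i + q ^ (n - j) * g (Suc i)" if "i \<le> N" for i
  proof (cases "Suc i + j \<le> n \<and> i < N")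
    case True
    then obtain d e where d: "n = Suc i + j + d" and e: "N = i + Suc e"
      by (metis le_add_diff_inverse less_imp_Suc_add add_Suc_right)
    show ?thesis
      unfolding f_def g_def h_def q_pascal(1)
      by (simp add: d e power_add algebra_simps)
  next
    case False
    with that show ?thesis
      by (auto simp: f_def g_def h_def q_pascal(1) q_binomial_eq_0)
  qed
  have f0: "f 0 = q ^ (n - j) * g 0"
    by (simp add: f_def g_def power_add)
  have gS: "g (Suc N) = 0" by (simp add: g_def q_binomial_eq_0)
  have "(\<Sum>i\<le>Suc N. f i) = f 0 + (\<Sum>i\<le>N. f (Suc i))"
    by (rule sum.atMost_Suc_shift)
  also have "\<dots> = q ^ (n - j) * (g 0 + (\<Sum>i\<le>N. g (Suc i))) + (\<Sum>i\<le>N. h i)"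
    by (simp add: fS f0 sum.distrib sum_distrib_left algebra_simps)
  also have "g 0 + (\<Sum>i\<le>N. g (Suc i)) = (\<Sum>i\<le>N. g i)"
    using sum.atMost_Suc_shift[of g N] gS by simp
  also have "\<dots> = qbin (N + n) (N + j)" unfolding g_def by (rule Suc.IH)
  also have "(\<Sum>i\<le>N. h i) = qbin (N + n) (N + Suc j)" unfolding h_def by (rule Suc.IH)
  also have "q ^ (n - j) * qbin (N + n) (N + j) + qbin (N + n) (N + Suc j) = qbin (Suc N + n) (Suc N + j)"
    using q_pascal(2)[of "N + n" "N + j"] by simp
  finally show ?case by (simp add: f_def)
qed

text \<open>
  The second variable \<open>z\<close> makes the theorem applicable to products centred at a power of \<open>q\<close>, as
  in the Jacobi triple product, with non-negative exponents only.
\<close>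

lemma q_binomial_theorem:
  "(\<Prod>i<N. z + x * q ^ i) = (\<Sum>j\<le>N. qbin N j * q ^ (j choose 2) * x ^ j * z ^ (N - j))"
proof (induction N)
  case 0
  show ?case by (simp add: binomial_eq_0)
next
  case (Suc N)
  define f where "f j = qbin (Suc N) j * q ^ (j choose 2) * x ^ j * z ^ (Suc N - j)" for j
  define g where "g j = qbin N j * q ^ (j choose 2) * x ^ j * z ^ (N - j)" for j
  have fS: "f (Suc j) = x * q ^ N * g j + z * g (Suc j)" if "j \<le> N" for j
  proof (cases "j < N")
    case True
    then obtain e where e: "N = j + Suc e" by (metis less_imp_Suc_add add_Suc_right)
    show ?thesis unfolding f_def g_def q_pascal(2)
      by (simp add: e power_add algebra_simps numeral_2_eq_2)
  next
    case False
    with that show ?thesis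
      by (simp add: f_def g_def q_binomial_eq_0 power_add algebra_simps numeral_2_eq_2)
  qed
  have f0: "f 0 = z * g 0" by (simp add: f_def g_def)
  have gS: "g (Suc N) = 0" by (simp add: g_def q_binomial_eq_0)
  have "(\<Sum>j\<le>Suc N. f j) = f 0 + (\<Sum>j\<le>N. f (Suc j))"
    by (rule sum.atMost_Suc_shift)
  also have "\<dots> = x * q ^ N * (\<Sum>j\<le>N. g j) + z * (g 0 + (\<Sum>j\<le>N. g (Suc j)))"
    by (simp add: fS f0 sum.distrib sum_distrib_left algebra_simps)
  also have "g 0 + (\<Sum>j\<le>N. g (Suc j)) = (\<Sum>j\<le>N. g j)"
    using sum.atMost_Suc_shift[of g N] gS by simp
  finally show ?case
    using Suc.IH by (simp add: f_def g_def algebra_simps)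
qed

lemma q_falling_power:
  "q_falling (q ^ (k + e)) q k = (-1) ^ k * q ^ (k choose 2) * qfact (k + e) / qfact e"
proof (induction k arbitrary: e)
  case 0
  show ?case by (simp add: binomial_eq_0)
next
  case (Suc k)
  have "q_falling (q ^ (Suc k + e)) q (Suc k) =
    q_falling (q ^ (k + Suc e)) q k * (- (q ^ k) * (1 - q ^ Suc e))"
    by (simp add: q_falling_Suc power_add algebra_simps)
  also have "\<dots> = (-1) ^ Suc k * q ^ (Suc k choose 2) * qfact (Suc k + e) / qfact e"
    unfolding Suc.IH using one_minus_q_power_nonzero[of e]
    by (simp add: qfact_Suc[of e] numeral_2_eq_2 power_add divide_simps)
  finally show ?case .
qed

lemma q_shifted_fact_q_power: "q_shifted_fact (q ^ Suc n) q k = qfact (n + k) / qfact n"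
  using q_shifted_fact_add[of q q n k] by simp

text \<open>
  This is \<open>q_saalschuetz_polynomial\<close> with \<open>N = p\<close>, \<open>k = p - s\<close>, \<open>A = q^(u+p)\<close>, \<open>B = q^(v+p)\<close> and
  \<open>c = q^(r-p+1)\<close>. All terms are quotients of factors \<open>(q;q)\<^sub>n\<close>, and no signs remain because the two
  falling products contribute the same sign.
\<close>

lemma q_saalschuetz_qfact_le:
  assumes "p \<le> r"
  shows "(\<Sum>s\<le>p. q ^ ((p - s) * (r - s)) * qfact (p + r + u + v + s) /
      (qfact s * qfact (p - s) * qfact (r - s) * qfact (u + s) * qfact (v + s))) =
    qfact (u + p + r) * qfact (v + p + r) * qfact (u + v + p + r) /
      (qfact (u + r) * qfact (v + r) * qfact r * qfact p * qfact (u + p) * qfact (v + p))"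
proof -
  obtain d where r: "r = p + d" using assms le_Suc_ex by blast
  define f where "f s = q ^ ((p - s) * (r - s)) * qfact (p + r + u + v + s) /
      (qfact s * qfact (p - s) * qfact (r - s) * qfact (u + s) * qfact (v + s))" for s
  define A B c where "A = q ^ (u + p)" and "B = q ^ (v + p)" and "c = q ^ Suc d"
  define C where "C = qfact p * qfact r * qfact (u + p) * qfact (v + p) / qfact (p + r + u + v)"
  have summand: "qbin p k * c ^ k * q_falling A q k * q_falling B q k *
      q_shifted_fact (c * q ^ k) q (p - k) * q_shifted_fact (c * A * B) q (p - k) = C * f (p - k)"
    if "k \<le> p" for k
  proof -
    obtain s where p: "p = k + s" using \<open>k \<le> p\<close> le_Suc_ex by blast
    have A: "q_falling A q k = (-1) ^ k * q ^ (k choose 2) * qfact (u + p) / qfact (u + s)"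
      using q_falling_power[of k "u + s"] by (simp add: A_def p add_ac)
    have B: "q_falling B q k = (-1) ^ k * q ^ (k choose 2) * qfact (v + p) / qfact (v + s)"
      using q_falling_power[of k "v + s"] by (simp add: B_def p add_ac)
    have c1: "q_shifted_fact (c * q ^ k) q s = qfact r / qfact (d + k)"
      using q_shifted_fact_q_power[of "d + k" s] by (simp add: c_def r p power_add mult_ac add_ac)
    have "c * A * B = q ^ Suc (p + r + u + v)"
      by (simp add: c_def A_def B_def r power_add mult_ac)
    then have c2: "q_shifted_fact (c * A * B) q s = qfact (p + r + u + v + s) / qfact (p + r + u + v)"
      using q_shifted_fact_q_power[of "p + r + u + v" s] by simp
    have "c ^ k * q ^ (k choose 2) * q ^ (k choose 2) = q ^ (Suc d * k + 2 * (k choose 2))"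
      by (simp only: c_def power_add mult_2 power_mult mult.assoc)
    also have "Suc d * k + 2 * (k choose 2) = k * (k + d)"
      by (cases k) (simp_all add: choose_two algebra_simps)
    finally have e: "c ^ k * q ^ (k choose 2) * q ^ (k choose 2) = q ^ (k * (k + d))" .
    have sgn: "(-1) ^ k * (-1) ^ k = (1 :: 'a)"
      by (simp flip: power_add mult_2)
    have "qbin p k * c ^ k * q_falling A q k * q_falling B q k *
      q_shifted_fact (c * q ^ k) q s * q_shifted_fact (c * A * B) q s =
      ((-1) ^ k * (-1) ^ k) * (c ^ k * q ^ (k choose 2) * q ^ (k choose 2)) *
      (qfact p / (qfact k * qfact s)) * (qfact (u + p) / qfact (u + s)) * 
      (qfact (v + p) / qfact (v + s)) * (qfact r / qfact (d + k)) * 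
      (qfact (p + r + u + v + s) / qfact (p + r + u + v))"
      unfolding A B c1 c2 by (simp add: p qbin_add mult_ac)
    also have "\<dots> = C * f s"
      unfolding sgn e C_def f_def by (simp add: r p mult_ac add_ac)
    finally show ?thesis by (simp add: p)
  qed
  have "(\<Sum>s\<le>p. f s) = (\<Sum>k\<le>p. f (p - k))"
    by (rule sum.reindex_bij_witness[where i = "\<lambda>j. p - j" and j = "\<lambda>j. p - j"]) auto
  then have "C * (\<Sum>s\<le>p. f s) = (\<Sum>k\<le>p. C * f (p - k))"
    by (simp add: sum_distrib_left)
  also have "\<dots> = q_shifted_fact (c * A) q p * q_shifted_fact (c * B) q p"
    unfolding q_saalschuetz_polynomial[of p c A B, symmetric] by (rule sum.cong) (simp_all add: summand)
  also have "q_shifted_fact (c * A) q p = qfact (u + p + r) / qfact (u + r)"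
    using q_shifted_fact_q_power[of "u + r" p] by (simp add: c_def A_def r power_add mult_ac add_ac)
  also have "q_shifted_fact (c * B) q p = qfact (v + p + r) / qfact (v + r)"
    using q_shifted_fact_q_power[of "v + r" p] by (simp add: c_def B_def r power_add mult_ac add_ac)
  finally show ?thesis
    unfolding f_def[symmetric] C_def by (simp add: divide_simps add_ac mult_ac)
qed

text \<open>
  Both sides are symmetric in \<open>p\<close> and \<open>r\<close>, so the condition \<open>p \<le> r\<close> can be dropped.
  This lets the product formula treat \<open>m \<le> n\<close> and \<open>n \<le> m\<close> together.
\<close>

lemma q_saalschuetz_qfact:
  "(\<Sum>s\<le>min p r. q ^ ((p - s) * (r - s)) * qfact (p + r + u + v + s) /
      (qfact s * qfact (p - s) * qfact (r - s) * qfact (u + s) * qfact (v + s))) =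
    qfact (u + p + r) * qfact (v + p + r) * qfact (u + v + p + r) /
      (qfact (u + r) * qfact (v + r) * qfact r * qfact p * qfact (u + p) * qfact (v + p))"
proof (cases "p \<le> r")
  case True
  with q_saalschuetz_qfact_le[of p r u v] show ?thesis by (simp add: min_def)
next
  case False
  with q_saalschuetz_qfact_le[of r p u v] show ?thesis by (simp add: min_def mult_ac add_ac)
qed

section \<open>Delannoy polynomials\<close>

definition delannoy_coeff :: "nat \<Rightarrow> nat \<Rightarrow> nat \<Rightarrow> 'a" where
  "delannoy_coeff m n k = qbin n k * qbin (n + m - k) n"

definition delannoy_poly :: "nat \<Rightarrow> nat \<Rightarrow> 'a \<Rightarrow> 'a" where
  "delannoy_poly m n x = (\<Sum>k\<le>n. x ^ k * q ^ (k choose 2) * delannoy_coeff m n k)"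

lemma delannoy_coeff_eq_0: "n < k \<or> m < k \<Longrightarrow> delannoy_coeff m n k = 0"
  by (cases "n < k") (auto simp: delannoy_coeff_def q_binomial_eq_0)

lemma delannoy_coeff_eq:
  assumes "k \<le> n" "k \<le> m"
  shows "delannoy_coeff m n k = qfact (n + m - k) / (qfact k * qfact (n - k) * qfact (m - k))"
  using assms by (simp add: delannoy_coeff_def q_binomial_def)

lemma delannoy_coeff_commute: "delannoy_coeff m n k = delannoy_coeff n m k"
proof (cases "k \<le> n \<and> k \<le> m")
  case True
  then show ?thesis by (simp add: delannoy_coeff_eq add.commute mult_ac)
next
  case False
  then have "n < k \<or> m < k" "m < k \<or> n < k" by auto
  then show ?thesis by (simp add: delannoy_coeff_eq_0)
qed

lemma delannoy_poly_commute: "delannoy_poly m n x = delannoy_poly n m x"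
proof -
  have "delannoy_poly m n x = (\<Sum>k\<le>min m n. x ^ k * q ^ (k choose 2) * delannoy_coeff m n k)" for m n
    unfolding delannoy_poly_def
    by (rule sum.mono_neutral_right) (auto simp: delannoy_coeff_eq_0)
  from this[of m n] this[of n m] show ?thesis
    by (simp add: min.commute delannoy_coeff_commute[of m n])
qed

lemma q_shifted_fact_expand:
  "q_shifted_fact a q k = (\<Sum>j\<le>k. qbin k j * q ^ (j choose 2) * (- a) ^ j)"
  using q_binomial_theorem[where N = k and z = 1 and x = "- a"] by (simp add: q_shifted_fact_def)

text \<open>
  By the trinomial revision \<open>[m,k] [k,j] = [m,j] [m-j,k-j]\<close> the sum is a q-Vandermonde convolution.
\<close>

lemma sum_q_trinomial:
  "(\<Sum>k\<le>m. q ^ ((m - k) * (n - k)) * qbin m k * qbin n k * qbin k j) = delannoy_coeff n m j"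
proof (cases "j \<le> m")
  case True
  then obtain M where m: "m = M + j" using le_Suc_ex[of j m] by (auto simp: add.commute)
  define f where "f k = q ^ ((m - k) * (n - k)) * qbin m k * qbin n k * qbin k j" for k
  have tri: "qbin (M + j) (i + j) * qbin (i + j) j = qbin (M + j) j * qbin M i" if "i \<le> M" for i
    using that by (simp add: q_binomial_def)
  have "(\<Sum>k\<le>m. f k) = (\<Sum>k=0+j..M+j. f k)"
    by (rule sum.mono_neutral_right) (auto simp: f_def q_binomial_eq_0 m)
  also have "\<dots> = (\<Sum>i\<le>M. f (i + j))"
    by (simp only: sum.shift_bounds_cl_nat_ivl atMost_atLeast0)
  also have "\<dots> = qbin (M + j) j * (\<Sum>i\<le>M. q ^ ((M - i) * (n - j - i)) * qbin M i * qbin n (i + j))"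
    unfolding sum_distrib_left
  proof (rule sum.cong)
    fix i assume "i \<in> {..M}"
    then have "f (i + j) = q ^ ((M - i) * (n - j - i)) * qbin n (i + j) * (qbin (M + j) (i + j) * qbin (i + j) j)"
      by (simp add: f_def m mult_ac add.commute)
    also have "\<dots> = qbin (M + j) j * (q ^ ((M - i) * (n - j - i)) * qbin M i * qbin n (i + j))"
      using tri[of i] \<open>i \<in> {..M}\<close> by (simp add: mult_ac)
    finally show "f (i + j) = qbin (M + j) j * (q ^ ((M - i) * (n - j - i)) * qbin M i * qbin n (i + j))" .
  qed simp
  also have "\<dots> = delannoy_coeff n m j"
    unfolding q_vandermonde delannoy_coeff_def by (simp add: m add.commute)
  finally show ?thesis by (simp add: f_def)
next
  case False
  then show ?thesis by (simp add: delannoy_coeff_eq_0 q_binomial_eq_0)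
qed

text \<open>
  The coefficient of \<open>(-a)\<^sup>j\<close> on the right is a sum of the form \<open>sum_q_trinomial\<close>.
\<close>

theorem delannoy_poly_expand:
  "delannoy_poly n m (- a) =
    (\<Sum>k\<le>m. q ^ ((m - k) * (n - k)) * qbin m k * qbin n k * q_shifted_fact a q k)"
proof -
  define c where "c k = q ^ ((m - k) * (n - k)) * qbin m k * qbin n k" for k
  have ext: "q_shifted_fact a q k = (\<Sum>j\<le>m. qbin k j * q ^ (j choose 2) * (- a) ^ j)" if "k \<le> m" for k
    unfolding q_shifted_fact_expand using that
    by (intro sum.mono_neutral_left) (auto simp: q_binomial_eq_0)
  have "(\<Sum>k\<le>m. c k * q_shifted_fact a q k) =
    (\<Sum>k\<le>m. \<Sum>j\<le>m. (- a) ^ j * q ^ (j choose 2) * (c k * qbin k j))"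
    by (simp add: ext sum_distrib_left mult_ac)
  also have "\<dots> = (\<Sum>j\<le>m. (- a) ^ j * q ^ (j choose 2) * (\<Sum>k\<le>m. c k * qbin k j))"
    by (subst sum.swap) (simp add: sum_distrib_left)
  finally show ?thesis
    unfolding c_def sum_q_trinomial delannoy_poly_def by simp
qed

section \<open>The product formula\<close>

text \<open>
  For \<open>y = 1/x\<close> this collects the terms \<open>x\<^sup>i q^(i choose 2)\<close> with \<open>i = j\<close> and \<open>i = -j\<close>, since
  \<open>-j choose 2\<close> is \<open>j + 1 choose 2\<close>.
\<close>

definition jacobi_weight :: "'a \<Rightarrow> 'a \<Rightarrow> nat \<Rightarrow> 'a" where
  "jacobi_weight x y j =
    (if j = 0 then 1 else x ^ j * q ^ (j choose 2) + y ^ j * q ^ (Suc j choose 2))"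

text \<open>
  Specialise the q-binomial theorem to \<open>\<Prod>(q\<^sup>k + x q\<^sup>i)\<close> over \<open>i < 2k\<close>. The upper half of the product
  gives \<open>(-x;q)\<^sub>k\<close>, the lower half \<open>(-y q;q)\<^sub>k\<close> after extracting \<open>x\<^sup>k\<close>, and the terms with
  index \<open>k + t\<close> and \<open>k - t\<close> of the sum yield the two parts of the weight.
\<close>

lemma finite_jacobi_triple_product:
  assumes xy: "x * y = 1"
  shows "q_shifted_fact (- x) q k * q_shifted_fact (- (y * q)) q k =
    (\<Sum>j\<le>k. jacobi_weight x y j * qbin (2 * k) (k + j))"
proof -
  define e where "e = (k choose 2) + k * k"
  define f where "f j = qbin (2 * k) j * q ^ (j choose 2) * x ^ j * (q ^ k) ^ (2 * k - j)" for j
  have xy_pow: "x ^ i * y ^ i = 1" for i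
    by (simp add: xy flip: power_mult_distrib)
  have low: "(\<Prod>i<N. q ^ N + x * q ^ i) = q ^ (N choose 2) * x ^ N * q_shifted_fact (- (y * q)) q N" for N
  proof (induction N)
    case 0
    show ?case by (simp add: binomial_eq_0)
  next
    case (Suc N)
    have "(\<Prod>i<Suc N. q ^ Suc N + x * q ^ i) = (q ^ Suc N + x) * (\<Prod>i<N. q * (q ^ N + x * q ^ i))"
      by (subst prod.lessThan_Suc_shift) (simp add: algebra_simps)
    also have "q ^ Suc N + x = x * (1 + y * q * q ^ N)"
      using xy by (simp add: algebra_simps)
    finally show ?case
      by (simp add: prod.distrib Suc.IH q_shifted_fact_Suc Suc_choose_two power_add mult_ac)
  qed
  have high: "(\<Prod>i<k. q ^ k + x * q ^ (k + i)) = q ^ (k * k) * q_shifted_fact (- x) q k"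
  proof -
    have "(\<Prod>i<k. q ^ k + x * q ^ (k + i)) = (\<Prod>i<k. q ^ k * (1 - (- x) * q ^ i))"
      by (simp add: power_add algebra_simps)
    then show ?thesis
      by (simp add: prod.distrib q_shifted_fact_def power_mult)
  qed
  have "(\<Sum>j\<le>2 * k. f j) = (\<Prod>i<k + k. q ^ k + x * q ^ i)"
    unfolding f_def mult_2 by (rule q_binomial_theorem[symmetric])
  also have "\<dots> = (\<Prod>i<k. q ^ k + x * q ^ i) * (\<Prod>i<k. q ^ k + x * q ^ (k + i))"
    by (rule prod_lessThan_add)
  also have "\<dots> = q ^ e * x ^ k * (q_shifted_fact (- x) q k * q_shifted_fact (- (y * q)) q k)"
    unfolding low high e_def by (simp add: power_add mult_ac)
  finally have 1: "(\<Sum>j\<le>2 * k. f j) =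
    q ^ e * x ^ k * (q_shifted_fact (- x) q k * q_shifted_fact (- (y * q)) q k)" .
  have up: "f (k + t) = q ^ e * x ^ k * (x ^ t * q ^ (t choose 2) * qbin (2 * k) (k + t))"
    if "t \<le> k" for t
  proof -
    obtain d where k: "k = t + d" using \<open>t \<le> k\<close> le_Suc_ex by blast
    have "((k + t) choose 2) + k * (2 * k - (k + t)) = e + (t choose 2)"
      by (simp add: choose_two_add e_def k algebra_simps)
    then have "q ^ ((k + t) choose 2) * (q ^ k) ^ (2 * k - (k + t)) = q ^ e * q ^ (t choose 2)"
      by (metis power_add power_mult)
    then show ?thesis by (simp add: f_def power_add mult_ac)
  qed
  have down: "f (k - t) = q ^ e * x ^ k * (y ^ t * q ^ (Suc t choose 2) * qbin (2 * k) (k + t))"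
    if "t \<le> k" for t
  proof -
    obtain d where k: "k = t + d" using \<open>t \<le> k\<close> le_Suc_ex by blast
    have sym: "qbin (2 * k) (k - t) = qbin (2 * k) (k + t)"
      by (simp add: q_binomial_def k mult_2_right algebra_simps)
    have "(d choose 2) + k * (2 * k - d) = e + (Suc t choose 2)"
    proof -
      have "2 * (t choose 2) + t = t * t" by (cases t) (simp_all add: choose_two algebra_simps)
      then show ?thesis
        by (simp add: choose_two_add Suc_choose_two e_def k algebra_simps)
    qed
    then have "q ^ (d choose 2) * (q ^ k) ^ (2 * k - d) = q ^ e * q ^ (Suc t choose 2)"
      by (metis power_add power_mult)
    moreover have "x ^ k * y ^ t = x ^ d"
      using xy_pow[of t] by (simp add: k power_add mult_ac)
    ultimately have "q ^ (d choose 2) * (q ^ k) ^ (2 * k - d) * x ^ d = q ^ e * q ^ (Suc t choose 2) * (x ^ k * y ^ t)"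
      by simp
    moreover have "f (k - t) = q ^ (d choose 2) * (q ^ k) ^ (2 * k - d) * x ^ d * qbin (2 * k) (k + t)"
      unfolding f_def sym by (simp add: k mult_ac)
    ultimately show ?thesis by (simp add: mult_ac)
  qed
  have "(\<Sum>j\<le>2 * k. f j) = (\<Sum>t\<le>k. f (k + t)) + (\<Sum>t=1..k. f (k - t))"
  proof -
    have "(\<Sum>j\<le>2 * k. f j) = (\<Sum>j\<in>{k..2 * k}. f j) + (\<Sum>j<k. f j)"
      by (subst sum.union_disjoint[symmetric]) (auto intro!: sum.cong)
    also have "(\<Sum>j\<in>{k..2 * k}. f j) = (\<Sum>t\<le>k. f (k + t))"
      by (rule sum.reindex_bij_witness[where i = "\<lambda>t. k + t" and j = "\<lambda>j. j - k"]) auto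
    also have "(\<Sum>j<k. f j) = (\<Sum>t=1..k. f (k - t))"
      by (rule sum.reindex_bij_witness[where i = "\<lambda>t. k - t" and j = "\<lambda>j. k - j"]) auto
    finally show ?thesis .
  qed
  also have "(\<Sum>t=1..k. f (k - t)) = (\<Sum>t\<le>k. if t = 0 then 0 else f (k - t))"
    by (rule sum.mono_neutral_cong_left) auto
  also have "(\<Sum>t\<le>k. f (k + t)) + \<dots> =
    (\<Sum>t\<le>k. q ^ e * x ^ k * (jacobi_weight x y t * qbin (2 * k) (k + t)))"
    unfolding sum.distrib[symmetric]
  proof (rule sum.cong)
    fix t assume "t \<in> {..k}"
    then show "f (k + t) + (if t = 0 then 0 else f (k - t)) =
      q ^ e * x ^ k * (jacobi_weight x y t * qbin (2 * k) (k + t))"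
      using up[of t] down[of t] 
      by (simp add: jacobi_weight_def binomial_eq_0) (simp add: algebra_simps)
  qed simp
  also have "\<dots> = q ^ e * x ^ k * (\<Sum>t\<le>k. jacobi_weight x y t * qbin (2 * k) (k + t))"
    by (simp add: sum_distrib_left)
  finally have 2: "(\<Sum>j\<le>2 * k. f j) =
    q ^ e * x ^ k * (\<Sum>t\<le>k. jacobi_weight x y t * qbin (2 * k) (k + t))" .
  have "q ^ e * x ^ k \<noteq> 0" using q_nonzero xy by auto
  then show ?thesis using trans[OF 1[symmetric] 2] by (simp only: mult_cancel_left simp_thms)
qed

text \<open>
  The double sum of \<open>h\<close> is found by expanding \<open>(q;q)\<^sub>(n+k) (q;q)\<^sub>(m+k)\<close> in the summand on the right by
  \<open>q_saalschuetz_qfact\<close>. Summed over \<open>l\<close>, it returns that summand (fact \<open>row\<close>); summed over \<open>k\<close>, it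
  is of the same type again, and gives the summand on the left (fact \<open>column\<close>).
\<close>

lemma delannoy_coeff_correlation:
  "(\<Sum>l\<le>n. q ^ (l * (l + j)) * delannoy_coeff m n l * delannoy_coeff m n (l + j)) =
   (\<Sum>k\<le>n. q ^ ((m - k) * (n - k)) * qbin (n + k) (2 * k) * qbin m k * qbin (m + k) k *
      qbin (2 * k) (k + j))"
proof -
  define h where "h k l = (if l + j \<le> k \<and> k \<le> m \<and> k \<le> n then
      q ^ ((m - k) * (n - k)) * q ^ (l * (l + j)) * qfact (n + m + k - l) /
      (qfact (n - k) * qfact (m - k) * qfact k * qfact (k + j) * qfact l * qfact (k - j - l) *
       qfact (n - l) * qfact (m - l) * qfact (l + j)) else 0)" for k l
  define C where "C = qfact (n + j) * qfact (m + j) * qfact n * qfact m / qfact (n + m + j)"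
  have row: "C * (\<Sum>l\<le>n. h k l) =
    q ^ ((m - k) * (n - k)) * qbin (n + k) (2 * k) * qbin m k * qbin (m + k) k * qbin (2 * k) (k + j)"
    (is "_ = ?r") for k
  proof (cases "j \<le> k \<and> k \<le> m \<and> k \<le> n")
    case True
    then obtain p u v where k: "k = j + p" and n': "n = k + u" and m': "m = k + v"
      using le_Suc_ex[of j k] le_Suc_ex[of k n] le_Suc_ex[of k m] by blast
    then have n: "n = u + p + j" and m: "m = v + p + j" by simp_all
    \<comment> \<open>The sum over \<open>l\<close> runs backwards through \<open>q_saalschuetz_qfact\<close> with \<open>r = k\<close> and \<open>s = p - l\<close>.\<close>
    define u' v' where "u' = u + j" and "v' = v + j"
    have nm: "n = u' + p" "m = v' + p" by (simp_all add: n m u'_def v'_def)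
    define D where "D = q ^ ((m - k) * (n - k)) / (qfact (n - k) * qfact (m - k) * qfact k * qfact (k + j))"
    define g where "g s = q ^ ((p - s) * (k - s)) * qfact (p + k + u' + v' + s) /
      (qfact s * qfact (p - s) * qfact (k - s) * qfact (u' + s) * qfact (v' + s))" for s
    have "(\<Sum>l\<le>n. h k l) = (\<Sum>l\<le>p. h k l)"
      by (rule sum.mono_neutral_right) (auto simp: h_def k n)
    also have "\<dots> = (\<Sum>l\<le>p. D * g (p - l))"
    proof (rule sum.cong)
      fix l assume "l \<in> {..p}"
      then obtain s where p: "p = l + s" using le_Suc_ex by blast
      have diffs: "n - l = u' + s" "m - l = v' + s" "k - (j + l) = s" "l + j \<le> k" "k \<le> m" "k \<le> n"
        by (simp_all add: k p nm u'_def v'_def)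
      have "h k l = q ^ ((m - k) * (n - k)) * q ^ (l * (l + j)) * qfact (n + m + k - l) /
        (qfact (n - k) * qfact (m - k) * qfact k * qfact (k + j) * qfact l * qfact s *
         qfact (u' + s) * qfact (v' + s) * qfact (l + j))"
        by (simp add: h_def diffs)
      moreover have "g (p - l) = q ^ (l * (l + j)) * qfact (n + m + k - l) /
        (qfact s * qfact l * qfact (l + j) * qfact (u' + s) * qfact (v' + s))"
        by (simp add: g_def k p nm add_ac)
      ultimately show "h k l = D * g (p - l)"
        by (simp add: D_def mult_ac)
    qed simp
    also have "\<dots> = (\<Sum>s\<le>p. D * g s)"
      by (rule sum.reindex_bij_witness[where i = "\<lambda>j. p - j" and j = "\<lambda>j. p - j"]) auto
    also have "\<dots> = D * (\<Sum>s\<le>min p k. g s)"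
      by (simp add: k sum_distrib_left)
    also have "(\<Sum>s\<le>min p k. g s) = qfact (u' + p + k) * qfact (v' + p + k) * qfact (u' + v' + p + k) /
      (qfact (u' + k) * qfact (v' + k) * qfact k * qfact p * qfact (u' + p) * qfact (v' + p))"
      unfolding g_def by (rule q_saalschuetz_qfact)
    also have "\<dots> = qfact (n + k) * qfact (m + k) * qfact (n + m + j) /
      (qfact (n + j) * qfact (m + j) * qfact k * qfact (k - j) * qfact n * qfact m)"
      by (simp add: nm k add_ac)
    finally have inner: "(\<Sum>l\<le>n. h k l) = D * (qfact (n + k) * qfact (m + k) * qfact (n + m + j) /
      (qfact (n + j) * qfact (m + j) * qfact k * qfact (k - j) * qfact n * qfact m))" .
    have "C * (\<Sum>l\<le>n. h k l) = q ^ ((m - k) * (n - k)) * qfact (n + k) * qfact (m + k) /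
      (qfact (n - k) * qfact (m - k) * qfact k * qfact (k + j) * qfact k * qfact (k - j))"
      unfolding inner C_def D_def by (simp add: mult_ac)
    moreover have "?r = q ^ ((m - k) * (n - k)) * 
        (qfact (n + k) / (qfact (2 * k) * qfact (n - k))) * (qfact m / (qfact k * qfact (m - k))) *
        (qfact (m + k) / (qfact k * qfact m)) * (qfact (2 * k) / (qfact (k + j) * qfact (k - j)))"
      by (simp add: q_binomial_def k n m)
    ultimately show ?thesis by (simp add: mult_ac)
  next
    case False
    then have "(\<Sum>l\<le>n. h k l) = 0" by (intro sum.neutral) (auto simp: h_def)
    moreover have "?r = 0" using False by (auto simp: q_binomial_eq_0)
    ultimately show ?thesis by simp
  qed
  have column: "C * (\<Sum>k\<le>n. h k l) = q ^ (l * (l + j)) * delannoy_coeff m n l * delannoy_coeff m n (l + j)"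
    (is "_ = ?r") for l
  proof (cases "l + j \<le> m \<and> l + j \<le> n")
    case True
    then obtain p r where "n = (l + j) + p" and "m = (l + j) + r"
      using le_Suc_ex[of "l + j" n] le_Suc_ex[of "l + j" m] by blast
    then have n: "n = p + (l + j)" and m: "m = r + (l + j)" by simp_all
    \<comment> \<open>Here \<open>k = l + j + s\<close>; the parameters \<open>u\<close> and \<open>v\<close> are read off from the factors with index
      \<open>k\<close> and \<open>k + j\<close>.\<close>
    define u v where "u = l + j" and "v = l + j + j"
    define D where "D = q ^ (l * (l + j)) / (qfact l * qfact (n - l) * qfact (m - l) * qfact (l + j))"
    define g where "g s = q ^ ((p - s) * (r - s)) * qfact (p + r + u + v + s) /
      (qfact s * qfact (p - s) * qfact (r - s) * qfact (u + s) * qfact (v + s))" for s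
    have "(\<Sum>k\<le>n. h k l) = (\<Sum>k\<in>{l + j..l + j + min p r}. h k l)"
      by (rule sum.mono_neutral_right) (auto simp: h_def n m)
    also have "\<dots> = (\<Sum>s\<le>min p r. h (l + j + s) l)"
      by (rule sum.reindex_bij_witness[where i = "\<lambda>s. l + j + s" and j = "\<lambda>k. k - (l + j)"]) auto
    also have "\<dots> = (\<Sum>s\<le>min p r. D * g s)"
    proof (rule sum.cong)
      fix s assume "s \<in> {..min p r}"
      then have s: "s \<le> p" "s \<le> r" by auto
      have "h (l + j + s) l = q ^ ((p - s) * (r - s)) * q ^ (l * (l + j)) * qfact (n + m + (l + j + s) - l) /
        (qfact (p - s) * qfact (r - s) * qfact (u + s) * qfact (v + s) * qfact l * qfact s *
         qfact (n - l) * qfact (m - l) * qfact (l + j))"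
        using s by (simp add: h_def n m u_def v_def add_ac mult_ac)
      moreover have "g s = q ^ ((p - s) * (r - s)) * qfact (n + m + (l + j + s) - l) /
      (qfact s * qfact (p - s) * qfact (r - s) * qfact (u + s) * qfact (v + s))"
        by (simp add: g_def n m u_def v_def add_ac)
      ultimately show "h (l + j + s) l = D * g s"
        by (simp add: D_def mult_ac)
    qed simp
    also have "\<dots> = D * (\<Sum>s\<le>min p r. g s)"
      by (simp add: sum_distrib_left)
    also have "(\<Sum>s\<le>min p r. g s) = qfact (u + p + r) * qfact (v + p + r) * qfact (u + v + p + r) /
      (qfact (u + r) * qfact (v + r) * qfact r * qfact p * qfact (u + p) * qfact (v + p))"
      unfolding g_def by (rule q_saalschuetz_qfact)
    also have "\<dots> = qfact (n + m - (l + j)) * qfact (n + m - l) * qfact (n + m + j) /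
      (qfact m * qfact (m + j) * qfact (m - (l + j)) * qfact (n - (l + j)) * qfact n * qfact (n + j))"
      by (simp add: n m u_def v_def add_ac)
    finally have inner: "(\<Sum>k\<le>n. h k l) = D * (qfact (n + m - (l + j)) * qfact (n + m - l) * qfact (n + m + j) /
      (qfact m * qfact (m + j) * qfact (m - (l + j)) * qfact (n - (l + j)) * qfact n * qfact (n + j)))" .
    have "C * (\<Sum>k\<le>n. h k l) = q ^ (l * (l + j)) * qfact (n + m - (l + j)) * qfact (n + m - l) /
      (qfact l * qfact (n - l) * qfact (m - l) * qfact (l + j) * qfact (m - (l + j)) * qfact (n - (l + j)))"
      unfolding inner C_def D_def by (simp add: mult_ac)
    then show ?thesis using True by (simp add: delannoy_coeff_eq mult_ac)
  next
    case False
    then have "(\<Sum>k\<le>n. h k l) = 0" by (intro sum.neutral) (auto simp: h_def)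
    moreover have "?r = 0" using False by (auto simp: delannoy_coeff_eq_0)
    ultimately show ?thesis by simp
  qed
  have "(\<Sum>l\<le>n. C * (\<Sum>k\<le>n. h k l)) = (\<Sum>k\<le>n. C * (\<Sum>l\<le>n. h k l))"
    by (simp only: sum_distrib_left[symmetric] sum.swap[of h])
  then show ?thesis unfolding row column .
qed

text \<open>
  The pairs of indices with difference \<open>\<plusminus>j\<close> contribute the \<open>j\<close>-th correlation of the coefficients,
  weighted exactly as in the finite Jacobi triple product.
\<close>

theorem delannoy_poly_product:
  assumes xy: "x * y = 1"
  shows "delannoy_poly m n x * delannoy_poly m n (y * q) =
    (\<Sum>k\<le>n. q ^ ((m - k) * (n - k)) * qbin (n + k) (2 * k) * qbin m k * qbin (m + k) k *
      q_shifted_fact (- x) q k * q_shifted_fact (- (y * q)) q k)"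
proof -
  define T where "T = delannoy_coeff m n"
  define f where "f i l = (x ^ i * q ^ (i choose 2) * T i) * ((y * q) ^ l * q ^ (l choose 2) * T l)" for i l
  define c where "c k = q ^ ((m - k) * (n - k)) * qbin (n + k) (2 * k) * qbin m k * qbin (m + k) k" for k
  have xy_pow: "x ^ i * y ^ i = 1" for i
    by (simp add: xy flip: power_mult_distrib)
  have sq: "2 * (l choose 2) + l = l * l" for l :: nat
    by (cases l) (simp_all add: choose_two algebra_simps)
  have lower: "f (l + j) l = x ^ j * q ^ (j choose 2) * (q ^ (l * (l + j)) * T l * T (l + j))" for l j
  proof -
    have "((l + j) choose 2) + l + (l choose 2) = (j choose 2) + l * (l + j)"
      using sq[of l] by (simp add: choose_two_add algebra_simps)
    then have "q ^ ((l + j) choose 2) * q ^ l * q ^ (l choose 2) = q ^ (j choose 2) * q ^ (l * (l + j))"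
      by (metis power_add)
    moreover have "f (l + j) l = (x ^ l * y ^ l) * x ^ j *
        (q ^ ((l + j) choose 2) * q ^ l * q ^ (l choose 2)) * T l * T (l + j)"
      by (simp add: f_def power_add power_mult_distrib mult_ac)
    ultimately show ?thesis by (simp add: xy_pow mult_ac)
  qed
  have upper: "f l (l + j) = y ^ j * q ^ (Suc j choose 2) * (q ^ (l * (l + j)) * T l * T (l + j))" for l j
  proof -
    have "(l choose 2) + (l + j) + ((l + j) choose 2) = (Suc j choose 2) + l * (l + j)"
      using sq[of l] by (simp add: choose_two_add Suc_choose_two algebra_simps)
    then have "q ^ (l choose 2) * q ^ (l + j) * q ^ ((l + j) choose 2) = q ^ (Suc j choose 2) * q ^ (l * (l + j))"
      by (metis power_add)
    moreover have "f l (l + j) = (x ^ l * y ^ l) * y ^ j *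
        (q ^ (l choose 2) * q ^ (l + j) * q ^ ((l + j) choose 2)) * T l * T (l + j)"
      by (simp only: f_def power_add power_mult_distrib mult_ac)
    ultimately show ?thesis by (simp add: xy_pow mult_ac)
  qed
  have "delannoy_poly m n x * delannoy_poly m n (y * q) = (\<Sum>i\<le>n. \<Sum>l\<le>n. f i l)"
    by (simp add: delannoy_poly_def sum_product f_def T_def)
  also have "\<dots> = (\<Sum>j\<le>n. \<Sum>l\<le>n - j. f (l + j) l + (if j = 0 then 0 else f l (l + j)))"
    by (rule sum_square_by_diagonals)
  also have "\<dots> = (\<Sum>j\<le>n. jacobi_weight x y j * (\<Sum>l\<le>n. q ^ (l * (l + j)) * T l * T (l + j)))"
  proof (rule sum.cong)
    fix j assume "j \<in> {..n}"
    have "f (l + j) l + (if j = 0 then 0 else f l (l + j)) =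
        jacobi_weight x y j * (q ^ (l * (l + j)) * T l * T (l + j))" for l
      unfolding lower upper by (simp add: jacobi_weight_def binomial_eq_0 distrib_right)
    moreover have "(\<Sum>l\<le>n - j. q ^ (l * (l + j)) * T l * T (l + j)) =
      (\<Sum>l\<le>n. q ^ (l * (l + j)) * T l * T (l + j))"
      by (rule sum.mono_neutral_left) (auto simp: T_def intro!: delannoy_coeff_eq_0)
    ultimately show "(\<Sum>l\<le>n - j. f (l + j) l + (if j = 0 then 0 else f l (l + j))) =
      jacobi_weight x y j * (\<Sum>l\<le>n. q ^ (l * (l + j)) * T l * T (l + j))"
      by (simp flip: sum_distrib_left)
  qed simp
  also have "\<dots> = (\<Sum>j\<le>n. \<Sum>k\<le>n. c k * (jacobi_weight x y j * qbin (2 * k) (k + j)))"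
    unfolding T_def delannoy_coeff_correlation c_def by (simp add: sum_distrib_left mult_ac)
  also have "\<dots> = (\<Sum>k\<le>n. c k * (\<Sum>j\<le>n. jacobi_weight x y j * qbin (2 * k) (k + j)))"
    by (subst sum.swap) (simp add: sum_distrib_left)
  also have "\<dots> = (\<Sum>k\<le>n. c k * (\<Sum>j\<le>k. jacobi_weight x y j * qbin (2 * k) (k + j)))"
    by (intro sum.cong refl arg_cong2[where f = "(*)"] sum.mono_neutral_right) (auto simp: q_binomial_eq_0)
  finally show ?thesis
    unfolding finite_jacobi_triple_product[OF xy, symmetric] c_def by (simp add: mult_ac)
qed

section \<open>The q-Delannoy numbers\<close>

lemma q_delannoy_eq: "q_delannoy q m n = delannoy_poly m n 1"
  by (simp add: q_delannoy_def delannoy_poly_def delannoy_coeff_def atMost_atLeast0 mult_ac)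

lemma q_delannoy_star_eq: "q_delannoy_star q m n = delannoy_poly m n q"
  by (simp add: q_delannoy_star_def delannoy_poly_def delannoy_coeff_def atMost_atLeast0
      numeral_2_eq_2 power_add mult_ac)

lemma powi_eq_power:
  assumes "k \<le> m" "k \<le> n"
  shows "q powi ((int m - int k) * (int n - int k)) = q ^ ((m - k) * (n - k))"
  using assms by (simp flip: of_nat_diff of_nat_mult)

text \<open>
  The integer exponent differs from the truncated one only where \<open>k\<close> exceeds \<open>m\<close> or \<open>n\<close>, and there
  the summands to which this is applied contain a vanishing q-binomial coefficient.
\<close>

lemma sum_powi_eq_sum_power:
  assumes "\<And>k. \<lbrakk>k \<le> N; \<not> (k \<le> m \<and> k \<le> n)\<rbrakk> \<Longrightarrow> f k = 0"
  shows "(\<Sum>k=0..N. q powi ((int m - int k) * (int n - int k)) * f k) =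
    (\<Sum>k\<le>N. q ^ ((m - k) * (n - k)) * f k)"
  unfolding atMost_atLeast0
proof (rule sum.cong)
  fix k assume "k \<in> {0..N}"
  then show "q powi ((int m - int k) * (int n - int k)) * f k = q ^ ((m - k) * (n - k)) * f k"
    using assms[of k] by (cases "k \<le> m \<and> k \<le> n") (auto simp: powi_eq_power)
qed simp

lemma delannoy_poly_expand_powi:
  "delannoy_poly n m (- a) = (\<Sum>k=0..m. q powi ((int m - int k) * (int n - int k)) *
     qbin m k * qbin n k * q_shifted_fact a q k)"
  unfolding delannoy_poly_expand mult.assoc
  by (rule sum_powi_eq_sum_power[symmetric]) (auto simp: q_binomial_eq_0)

lemma delannoy_poly_product_powi:
  assumes xy: "x * y = 1"
  shows "delannoy_poly m n x * delannoy_poly m n (y * q) =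
    (\<Sum>k=0..n. q powi ((int m - int k) * (int n - int k)) *
      qbin (n + k) (2 * k) * qbin m k * qbin (m + k) k *
      q_shifted_fact (- x) q k * q_shifted_fact (- (y * q)) q k)"
  unfolding delannoy_poly_product[OF xy] mult.assoc
  by (rule sum_powi_eq_sum_power[symmetric]) (auto simp: q_binomial_eq_0)

end

lemma generic_q_indet: "generic_q (q_indet :: 'a::idom poly fract)"
proof
  show "(q_indet :: 'a poly fract) \<noteq> 0"
    by (simp add: q_indet_def eq_fract Zero_fract_def)
next
  fix i :: nat assume i: "0 < i"
  have pow: "(q_indet :: 'a poly fract) ^ k = Fract (monom 1 k) 1" for k
    by (induction k) (simp_all add: q_indet_def One_fract_def monom_Suc)
  show "(q_indet :: 'a poly fract) ^ i \<noteq> 1"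
  proof
    assume "(q_indet :: 'a poly fract) ^ i = 1"
    then have "monom (1 :: 'a) i = 1"
      by (simp add: pow One_fract_def eq_fract)
    then have "degree (monom (1 :: 'a) i) = 0" by simp
    with i show False by (simp add: degree_monom_eq)
  qed
qed

theorem theorem1p5:
  fixes m n :: nat and q :: "'a::idom poly fract"
  assumes "q = q_indet"
  shows "(q_delannoy q m n =
           (\<Sum>k=0..m. q powi ((int m - int k) * (int n - int k)) *
              q_binomial q m k * q_binomial q n k * q_shifted_fact (-1) q k)) \<and>
         (q_delannoy_star q n m =
           (\<Sum>k=0..m. q powi ((int m - int k) * (int n - int k)) *
              q_binomial q m k * q_binomial q n k * q_shifted_fact (- q) q k)) \<and>
         (q_delannoy q m n * q_delannoy_star q m n =
           (\<Sum>k=0..n. q powi ((int m - int k) * (int n - int k)) *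
              q_binomial q (n + k) (2 * k) * q_binomial q m k * q_binomial q (m + k) k *
              q_shifted_fact (-1) q k * q_shifted_fact (- q) q k))"
proof -
  interpret generic_q q
    unfolding assms by (rule generic_q_indet)
  have "q_delannoy q m n = delannoy_poly n m (- (- 1))"
    by (simp add: q_delannoy_eq delannoy_poly_commute)
  moreover have "q_delannoy_star q n m = delannoy_poly n m (- (- q))"
    by (simp add: q_delannoy_star_eq)
  moreover have "q_delannoy q m n * q_delannoy_star q m n =
      delannoy_poly m n 1 * delannoy_poly m n (1 * q)"
    by (simp add: q_delannoy_eq q_delannoy_star_eq)
  ultimately show ?thesis
    unfolding delannoy_poly_expand_powi delannoy_poly_product_powi[OF mult_1] by simp
qed

end
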